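(* For every real $c\ge 2$ and every integer $k>(c^2+1)^2$, we have $g(n,k,ck+1)=O\big(n^{1+\frac{c^2+1}{k}}\big)$ as $n\to\infty$, where the implied constant may depend on $c$ and $k$.
   Context: For a finite set $A\subset\mathbb{R}$, define its (positive) difference set $A-A=\{a-a' : a,a'\in A,\ a-a'>0\}$. For positive integers $n,k$ and a real $\ell$, let $g(n,k,\ell)$ be the minimum of $|A-A|$ over all sets $A$ of $n$ real numbers such that every subset $A'\subset A$ with $|A'|=k$ satisfies $|A'-A'|\ge \ell$. *)

theory Defs
  imports "HOL-Library.Landau_Symbols"
begin

definition diffset :: "real set \<Rightarrow> real set" where
  "diffset A = {a - a' | a a'. a \<in> A \<and> a' \<in> A \<and> a - a' > 0}"

definition locally_diverse :: "nat \<Rightarrow> nat \<Rightarrow> real \<Rightarrow> real set \<Rightarrow> bool" where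
  "locally_diverse n k l A \<longleftrightarrow>
     finite A \<and> card A = n \<and>
     (\<forall>A'. A' \<subseteq> A \<and> card A' = k \<longrightarrow> real (card (diffset A')) \<ge> l)"

text \<open>
  The infimum of a set of natural numbers is its least element, except that it is \<^term>\<open>0::nat\<close> for
  the empty set. The exception does not arise when \<open>l \<le> k (k - 1) / 2\<close>: see
  \<open>locally_diverse_exists\<close> and \<open>g_attained\<close> below.
\<close>

definition g :: "nat \<Rightarrow> nat \<Rightarrow> real \<Rightarrow> nat" where
  "g n k l = Inf {card (diffset A) | A. locally_diverse n k l A}"

lemma finite_diffset:
  assumes "finite A"
  shows "finite (diffset A)"
proof -
  have "diffset A \<subseteq> (\<lambda>(a, b). a - b) ` (A \<times> A)"
    by (auto simp: diffset_def)
  then show ?thesis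
    using assms finite_subset by blast
qed

lemma card_diffset_powers_of_two:
  fixes S :: "nat set"
  assumes "finite S"
  shows "card S * (card S - 1) \<le> 2 * card (diffset ((\<lambda>i. 2 ^ i) ` S))"
  using assms
proof (induction S rule: finite_linorder_max_induct)
  case empty
  then show ?case by simp
next
  case (insert m S)
  let ?p = "\<lambda>i::nat. (2::real) ^ i"
  let ?D = "diffset (?p ` S)" and ?N = "(\<lambda>i. ?p m - ?p i) ` S"
  have half: "2 * ?p i \<le> ?p m" if "i \<in> S" for i
  proof -
    have "Suc i \<le> m" using insert.hyps(2) that by auto
    then have "?p (Suc i) \<le> ?p m" by (intro power_increasing) auto
    then show ?thesis by simp
  qed
  have disj: "?D \<inter> ?N = {}"
  proof -
    have "?p i - ?p j \<noteq> ?p m - ?p h" if "i \<in> S" "j \<in> S" "h \<in> S" for i j h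
    proof -
      have "?p j > 0" by simp
      then show ?thesis using half[OF that(1)] half[OF that(3)] by linarith
    qed
    then show ?thesis unfolding diffset_def by blast
  qed
  have new: "?p m - ?p i > 0" if "i \<in> S" for i
  proof -
    have "?p i > 0" by simp
    then show ?thesis using half[OF that] by linarith
  qed
  have sub: "?D \<union> ?N \<subseteq> diffset (?p ` insert m S)"
    using new unfolding diffset_def by blast
  have "card ?N = card S"
    by (rule card_image) (auto simp: inj_on_def)
  then have "card (?D \<union> ?N) = card ?D + card S"
    using disj insert.hyps(1) by (simp add: card_Un_disjoint finite_diffset)
  moreover have "card (?D \<union> ?N) \<le> card (diffset (?p ` insert m S))"
    using sub insert.hyps(1) by (intro card_mono finite_diffset) auto
  moreover have "card (insert m S) = Suc (card S)"
    using insert.hyps by auto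
  moreover have "Suc s * s = s * (s - 1) + 2 * s" for s :: nat
    by (cases s) auto
  ultimately show ?case
    using insert.IH by simp
qed

lemma locally_diverse_exists:
  assumes "2 * l \<le> real (k * (k - 1))"
  shows "\<exists>A. locally_diverse n k l A"
proof
  let ?p = "\<lambda>i::nat. (2::real) ^ i"
  have inj: "inj_on ?p T" for T
    by (auto simp: inj_on_def)
  show "locally_diverse n k l (?p ` {..<n})"
    unfolding locally_diverse_def
  proof (intro conjI allI impI)
    show "card (?p ` {..<n}) = n" by (simp add: card_image[OF inj])
  next
    fix A' assume *: "A' \<subseteq> ?p ` {..<n} \<and> card A' = k"
    then obtain S where S: "S \<subseteq> {..<n}" "A' = ?p ` S"
      by (meson subset_imageE)
    then have "finite S" "card S = k"
      using * finite_subset by (auto simp: card_image[OF inj])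
    then have "k * (k - 1) \<le> 2 * card (diffset A')"
      using card_diffset_powers_of_two S(2) by blast
    then have "real (k * (k - 1)) \<le> real (2 * card (diffset A'))"
      by (rule of_nat_mono)
    then show "l \<le> real (card (diffset A'))" using assms by simp
  qed simp
qed

lemma g_attained:
  assumes "2 * l \<le> real (k * (k - 1))"
  shows "\<exists>A. locally_diverse n k l A \<and> card (diffset A) = g n k l"
proof -
  have "{card (diffset A) | A. locally_diverse n k l A} \<noteq> {}"
    using locally_diverse_exists[OF assms] by blast
  then have "g n k l \<in> {card (diffset A) | A. locally_diverse n k l A}"
    unfolding g_def by (rule Inf_nat_def1)
  then show ?thesis by force
qed

end

theory Submission imports Defs "HOL-Library.FuncSet" begin

text \<open>
  A \<open>k\<close>-set with fewer than \<open>c k + 1\<close> differences has small dimension: all its elements are reached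
  from at most \<open>r = \<lfloor>c\<^sup>2\<rfloor> + 1\<close> of them by boundedly many completions of parallelograms \<open>x + y - z\<close>.
  Hence \<open>{1..N}\<close> contains only \<open>O(N\<^sup>r)\<close> such bad sets. A random \<open>2n\<close>-subset of \<open>{1..N}\<close> contains on
  average \<open>O(N\<^sup>r (2n/N)\<^sup>k)\<close> of them, which is at most \<open>n\<close> when \<open>N\<close> is a large multiple of
  \<open>n powr (1 + (c\<^sup>2 + 1) / k)\<close>; here \<open>k > (c\<^sup>2 + 1)\<^sup>2\<close> enters. Deleting a point of each bad set leaves
  a suitable set of \<open>n\<close> integers whose differences lie in \<open>{1..N}\<close>.
\<close>

section \<open>Completing parallelograms\<close>

text \<open>Signed, and for two sets, because the induction removes the maximum of one set and the
  minimum of the other.\<close>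

definition differences :: "real set \<Rightarrow> real set \<Rightarrow> real set" where
  "differences A B = {x - y | x y. x \<in> A \<and> y \<in> B}"

definition parallelogram_step :: "real set \<Rightarrow> real set" where
  "parallelogram_step T = {x + y - z | x y z. x \<in> T \<and> y \<in> T \<and> z \<in> T}"

lemma parallelogram_stepI:
  "x \<in> T \<Longrightarrow> y \<in> T \<Longrightarrow> z \<in> T \<Longrightarrow> x + y - z \<in> parallelogram_step T"
  unfolding parallelogram_step_def by blast

lemma parallelogram_step_extensive: "T \<subseteq> parallelogram_step T"
proof
  fix x assume "x \<in> T"
  then show "x \<in> parallelogram_step T"
    using parallelogram_stepI[of x T x x] by simp
qed

lemma parallelogram_step_mono: "S \<subseteq> T \<Longrightarrow> parallelogram_step S \<subseteq> parallelogram_step T"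
  unfolding parallelogram_step_def by blast

lemma parallelogram_steps_mono:
  "S \<subseteq> T \<Longrightarrow> (parallelogram_step ^^ j) S \<subseteq> (parallelogram_step ^^ j) T"
  by (induction j) (auto dest: parallelogram_step_mono)

lemma parallelogram_steps_le:
  assumes "i \<le> j"
  shows "(parallelogram_step ^^ i) T \<subseteq> (parallelogram_step ^^ j) T"
  using assms
proof (induction rule: dec_induct)
  case (step j)
  then show ?case using parallelogram_step_extensive[of "(parallelogram_step ^^ j) T"] by auto
qed simp

lemma parallelogram_steps_extensive: "T \<subseteq> (parallelogram_step ^^ j) T"
  using parallelogram_steps_le[of 0 j T] by simp

lemma parallelogram_steps_empty: "(parallelogram_step ^^ j) {} = {}"
  by (induction j) (auto simp: parallelogram_step_def)

lemma card_parallelogram_step: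
  assumes "finite T"
  shows "finite (parallelogram_step T)" and "card (parallelogram_step T) \<le> card T ^ 3"
proof -
  have eq: "parallelogram_step T = (\<lambda>(x, y, z). x + y - z) ` (T \<times> T \<times> T)"
    unfolding parallelogram_step_def by force
  then show "finite (parallelogram_step T)" using assms by simp
  have "card (parallelogram_step T) \<le> card (T \<times> T \<times> T)"
    unfolding eq using assms by (intro card_image_le) auto
  also have "\<dots> = card T ^ 3" by (simp add: card_cartesian_product power3_eq_cube)
  finally show "card (parallelogram_step T) \<le> card T ^ 3" .
qed

text \<open>What matters is that the bound depends on \<open>card T\<close> and \<open>j\<close>
  alone, so a fixed \<open>T\<close> generates boundedly many sets.\<close>

lemma card_parallelogram_steps:
  assumes "finite T"
  shows "finite ((parallelogram_step ^^ j) T) \<and> card ((parallelogram_step ^^ j) T) \<le> card T ^ (3 ^ j)"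
proof (induction j)
  case (Suc j)
  let ?X = "(parallelogram_step ^^ j) T"
  have "card (parallelogram_step ?X) \<le> card ?X ^ 3"
    using Suc card_parallelogram_step by blast
  also have "\<dots> \<le> (card T ^ (3 ^ j)) ^ 3"
    using Suc by (intro power_mono) auto
  also have "\<dots> = card T ^ (3 ^ Suc j)"
    by (simp add: power_mult[symmetric] mult.commute)
  finally show ?case using Suc card_parallelogram_step by auto
qed (use assms in simp)

lemma finite_differences: "finite A \<Longrightarrow> finite B \<Longrightarrow> finite (differences A B)"
proof -
  assume "finite A" "finite B"
  moreover have "differences A B = (\<lambda>(x, y). x - y) ` (A \<times> B)"
    unfolding differences_def by force
  ultimately show ?thesis by simp
qed

section \<open>Sets with few differences\<close>

locale extremal_pair =
  fixes A B :: "real set" and a b :: real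
  assumes fin: "finite A" "finite B"
    and a: "a \<in> A" "\<And>x. x \<in> A \<Longrightarrow> x \<le> a"
    and b: "b \<in> B" "\<And>x. x \<in> B \<Longrightarrow> b \<le> x"
begin

text \<open>The gain of an induction step that restores \<open>a\<close> and \<open>b\<close>. Each
  member is some \<open>x - b\<close> or some \<open>a - y\<close>.\<close>

definition new_differences :: "real set" where
  "new_differences = differences A B - differences (A - {a}) (B - {b})"

lemma card_differences_split:
  "card (differences A B) = card (differences (A - {a}) (B - {b})) + card new_differences"
proof -
  have sub: "differences (A - {a}) (B - {b}) \<subseteq> differences A B"
    unfolding differences_def by blast
  have f: "finite (differences A B)" using fin by (rule finite_differences)
  show ?thesis
    unfolding new_differences_def
    using card_Diff_subset[OF finite_subset[OF sub f] sub] card_mono[OF f sub] by simp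
qed

lemma finite_new: "finite new_differences"
  unfolding new_differences_def using fin by (simp add: finite_differences)

lemma ab_new: "a - b \<in> new_differences"
proof -
  have "a - b \<noteq> x - y" if "x \<in> A - {a}" "y \<in> B - {b}" for x y
    using a(2)[of x] b(2)[of y] that by auto
  then show ?thesis
    using a(1) b(1) unfolding new_differences_def differences_def by blast
qed

text \<open>
  A difference \<open>x - b\<close> that is not new equals \<open>y - z\<close> with \<open>y < a\<close> and \<open>z > b\<close>, so
  \<open>x = b + y - z\<close> where \<open>y - b\<close> and \<open>a - z\<close> both exceed \<open>x - b\<close>. Descending through the values
  \<open>x - b\<close> and \<open>a - y\<close>, everything is reached from one representative per new difference.
\<close>

lemma generated_by_new:
  "\<exists>T \<subseteq> A \<union> B. finite T \<and> card T \<le> card new_differences + 1 \<and>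
     A \<union> B \<subseteq> (parallelogram_step ^^ (card A + card B)) T"
proof -
  \<comment> \<open>The reflection of \<open>t\<close> to \<open>a + b - t\<close> exchanges the two
    readings \<open>b + \<delta>\<close> and \<open>a - \<delta>\<close> of a value
    \<open>\<delta>\<close>.\<close>
  define D where "D = (\<lambda>x. x - b) ` A \<union> (\<lambda>y. a - y) ` B"
  have finD: "finite D" unfolding D_def using fin by simp
  have "card D \<le> card ((\<lambda>x. x - b) ` A) + card ((\<lambda>y. a - y) ` B)"
    unfolding D_def by (rule card_Un_le)
  then have cardD: "card D \<le> card A + card B"
    using card_image_le[OF fin(1), of "\<lambda>x. x - b"] card_image_le[OF fin(2), of "\<lambda>y. a - y"]
    by linarith
  have "\<exists>t \<in> A \<union> B. n = t - b \<or> n = a - t" if "n \<in> new_differences" for n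
    using that unfolding new_differences_def differences_def by blast
  then obtain \<rho> where \<rho>: "\<And>n. n \<in> new_differences \<Longrightarrow> \<rho> n \<in> A \<union> B \<and> (n = \<rho> n - b \<or> n = a - \<rho> n)"
    by metis
  \<comment> \<open>The difference \<open>a - b\<close> gets no representative, as \<open>a\<close>
    and \<open>b\<close> are both included; hence the bound
    \<open>card new_differences + 1\<close>.\<close>
  define T where "T = insert a (insert b (\<rho> ` (new_differences - {a - b})))"
  have TAB: "T \<subseteq> A \<union> B" unfolding T_def using a b \<rho> by auto
  have finT: "finite T" unfolding T_def using finite_new by simp
  have "card T \<le> Suc (Suc (card (\<rho> ` (new_differences - {a - b}))))"
    unfolding T_def by (simp add: card_insert_if finite_new)
  moreover have "card (\<rho> ` (new_differences - {a - b})) \<le> card (new_differences - {a - b})"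
    using finite_new by (intro card_image_le) simp
  moreover have "card (new_differences - {a - b}) = card new_differences - 1"
    using ab_new finite_new by simp
  moreover have "card new_differences > 0" using ab_new finite_new by (auto simp: card_gt_0_iff)
  ultimately have cardT: "card T \<le> card new_differences + 1" by linarith
  let ?P = "\<lambda>j. (parallelogram_step ^^ j) T"
  have abP: "a \<in> ?P j" "b \<in> ?P j" for j
    using parallelogram_steps_extensive[of T j] by (auto simp: T_def)
  \<comment> \<open>Both points are claimed, although only one need lie in
    \<open>A \<union> B\<close>: the induction hypothesis serves as
    \<open>y = b + \<epsilon>\<close> for \<open>y\<close> in \<open>A\<close> and as
    \<open>z = a - \<epsilon>\<close> for \<open>z\<close> in \<open>B\<close>.\<close>
  have key: "b + \<delta> \<in> ?P (Suc (card {\<delta>' \<in> D. \<delta>' > \<delta>})) \<and> a - \<delta> \<in> ?P (Suc (card {\<delta>' \<in> D. \<delta>' > \<delta>}))"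
    if "\<delta> \<in> D" for \<delta>
    using that
  proof (induction "card {\<delta>' \<in> D. \<delta>' > \<delta>}" arbitrary: \<delta> rule: less_induct)
    case less
    let ?j = "card {\<delta>' \<in> D. \<delta>' > \<delta>}"
    show ?case
    proof (cases "\<delta> \<in> new_differences")
      case True
      have "\<exists>t \<in> T. b + \<delta> = t \<or> a - \<delta> = t"
      proof (cases "\<delta> = a - b")
        case True
        then show ?thesis by (auto simp: T_def)
      next
        case False
        then show ?thesis using True \<rho>[OF True] by (force simp: T_def)
      qed
      then obtain t where t: "t \<in> T" "b + \<delta> = t \<or> a - \<delta> = t" by blast
      have tP: "t \<in> ?P ?j" using t(1) parallelogram_steps_extensive by blast
      have "a + b - t \<in> ?P (Suc ?j)" "t \<in> ?P (Suc ?j)"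
        using parallelogram_stepI[OF abP tP] tP parallelogram_step_extensive by auto
      moreover have "(b + \<delta> = t \<and> a - \<delta> = a + b - t) \<or> (b + \<delta> = a + b - t \<and> a - \<delta> = t)"
        using t(2) by linarith
      ultimately show ?thesis by (elim disjE conjE) (simp_all only: simp_thms)
    next
      case False
      have "\<delta> \<in> differences A B"
        using less.prems a b unfolding D_def differences_def by blast
      then obtain y z where yz: "y \<in> A - {a}" "z \<in> B - {b}" "\<delta> = y - z"
        using False unfolding new_differences_def differences_def by blast
      have lt: "y < a" "b < z" using yz a(2)[of y] b(2)[of z] by force+
      have step: "w \<in> ?P ?j"
        if "\<epsilon> \<in> D" "\<epsilon> > \<delta>" "w = b + \<epsilon> \<or> w = a - \<epsilon>" for \<epsilon> w
      proof -
        have "{\<delta>' \<in> D. \<delta>' > \<epsilon>} \<subset> {\<delta>' \<in> D. \<delta>' > \<delta>}" using that by auto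
        then have less': "card {\<delta>' \<in> D. \<delta>' > \<epsilon>} < ?j"
          using finD by (intro psubset_card_mono) auto
        have "w \<in> ?P (Suc (card {\<delta>' \<in> D. \<delta>' > \<epsilon>}))"
          using less.hyps[OF less' that(1)] that(3) by blast
        then show ?thesis using parallelogram_steps_le[OF Suc_leI[OF less']] by blast
      qed
      have y: "y \<in> ?P ?j" using yz lt by (intro step[of "y - b"]) (auto simp: D_def)
      have z: "z \<in> ?P ?j" using yz lt by (intro step[of "a - z"]) (auto simp: D_def)
      have "b + y - z \<in> ?P (Suc ?j)" "a + z - y \<in> ?P (Suc ?j)"
        using parallelogram_stepI[OF abP(2) y z] parallelogram_stepI[OF abP(1) z y] by simp_all
      moreover have "b + \<delta> = b + y - z" "a - \<delta> = a + z - y" using yz(3) by simp_all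
      ultimately show ?thesis by (simp only: simp_thms)
    qed
  qed
  have bound: "Suc (card {\<delta>' \<in> D. \<delta>' > \<delta>}) \<le> card A + card B" if "\<delta> \<in> D" for \<delta>
  proof -
    have "{\<delta>' \<in> D. \<delta>' > \<delta>} \<subset> D" using that by auto
    then have "card {\<delta>' \<in> D. \<delta>' > \<delta>} < card D" using finD by (intro psubset_card_mono)
    then show ?thesis using cardD by linarith
  qed
  have "x \<in> ?P (card A + card B)" if "x \<in> A \<union> B" for x
  proof -
    have "x - b \<in> D \<or> a - x \<in> D" using that unfolding D_def by blast
    moreover have "x = b + (x - b)" "x = a - (a - x)" by simp_all
    ultimately obtain \<delta> where \<delta>: "\<delta> \<in> D" "x = b + \<delta> \<or> x = a - \<delta>" by blast
    then have "x \<in> ?P (Suc (card {\<delta>' \<in> D. \<delta>' > \<delta>}))" using key by blast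
    then show ?thesis using parallelogram_steps_le[OF bound[OF \<delta>(1)]] by blast
  qed
  then show ?thesis using TAB finT cardT by blast
qed

text \<open>\<open>X\<close> stands for what is already generated. If \<open>a\<close> or
  \<open>b\<close> is not generated from it, many differences must be new.\<close>

context
  fixes X :: "real set"
  assumes X: "(A - {a}) \<union> (B - {b}) \<subseteq> X"
begin

text \<open>An old difference \<open>a - y = x - z\<close> would complete
  \<open>a = x + y - z\<close> inside \<open>X\<close>. The case \<open>y = b\<close> is separate,
  since \<open>b\<close> need not lie in \<open>X\<close>.\<close>

lemma new_if_max_not_generated:
  assumes "a \<notin> parallelogram_step X"
  shows "(\<lambda>y. a - y) ` B \<subseteq> new_differences"
proof
  fix n assume "n \<in> (\<lambda>y. a - y) ` B"
  then obtain y where y: "y \<in> B" "n = a - y" by blast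
  show "n \<in> new_differences"
  proof (cases "y = b")
    case True
    then show ?thesis using ab_new y by simp
  next
    case False
    have "a - y \<noteq> x - z" if "x \<in> A - {a}" "z \<in> B - {b}" for x z
    proof
      assume "a - y = x - z"
      then have "a = x + y - z" by simp
      moreover have "x + y - z \<in> parallelogram_step X"
        using X that y False by (intro parallelogram_stepI) auto
      ultimately show False using assms by simp
    qed
    then have "n \<notin> differences (A - {a}) (B - {b})" unfolding y differences_def by blast
    moreover have "n \<in> differences A B" using a(1) y unfolding differences_def by blast
    ultimately show ?thesis unfolding new_differences_def by blast
  qed
qed

lemma new_if_min_not_generated:
  assumes "b \<notin> parallelogram_step X"
  shows "(\<lambda>x. x - b) ` A \<subseteq> new_differences"
proof
  fix n assume "n \<in> (\<lambda>x. x - b) ` A"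
  then obtain y where y: "y \<in> A" "n = y - b" by blast
  show "n \<in> new_differences"
  proof (cases "y = a")
    case True
    then show ?thesis using ab_new y by simp
  next
    case False
    have "y - b \<noteq> x - z" if "x \<in> A - {a}" "z \<in> B - {b}" for x z
    proof
      assume "y - b = x - z"
      then have "b = y + z - x" by simp
      moreover have "y + z - x \<in> parallelogram_step X"
        using X that y False by (intro parallelogram_stepI) auto
      ultimately show False using assms by simp
    qed
    then have "n \<notin> differences (A - {a}) (B - {b})" unfolding y differences_def by blast
    moreover have "n \<in> differences A B" using b(1) y unfolding differences_def by blast
    ultimately show ?thesis unfolding new_differences_def by blast
  qed
qed

lemma card_new_if_max_not_generated:
  assumes "a \<notin> parallelogram_step X"
  shows "card B \<le> card new_differences"
  using card_mono[OF finite_new new_if_max_not_generated[OF assms]]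
  by (simp add: card_image inj_on_def)

lemma card_new_if_min_not_generated:
  assumes "b \<notin> parallelogram_step X"
  shows "card A \<le> card new_differences"
  using card_mono[OF finite_new new_if_min_not_generated[OF assms]]
  by (simp add: card_image inj_on_def)

text \<open>The families \<open>a - y\<close> and \<open>x - b\<close> share only
  \<open>a - b\<close>: any other coincidence gives \<open>b = x + y - a\<close>. As this completion
  uses \<open>a\<close>, \<open>b\<close> must be out of reach from a set \<open>Y\<close>
  containing \<open>a\<close>.\<close>

lemma card_new_if_neither_generated:
  assumes "a \<notin> parallelogram_step X" and "a \<in> Y" "X \<subseteq> Y" "b \<notin> parallelogram_step Y"
  shows "card A + card B \<le> card new_differences + 1"
proof -
  let ?P = "(\<lambda>y. a - y) ` B" and ?Q = "(\<lambda>x. x - b) ` (A - {a})"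
  have "b \<notin> parallelogram_step X"
    using assms parallelogram_step_mono by blast
  then have sub: "?P \<union> ?Q \<subseteq> new_differences"
    using new_if_max_not_generated[OF assms(1)] new_if_min_not_generated by blast
  have "?P \<inter> ?Q = {}"
  proof (rule ccontr)
    assume "?P \<inter> ?Q \<noteq> {}"
    then obtain x y where xy: "y \<in> B" "x \<in> A - {a}" "a - y = x - b" by blast
    then have "y \<noteq> b" by auto
    then have "x + y - a \<in> parallelogram_step Y"
      using X xy assms by (intro parallelogram_stepI) auto
    moreover have "b = x + y - a" using xy(3) by simp
    ultimately show False using assms(4) by simp
  qed
  then have "card (?P \<union> ?Q) = card ?P + card ?Q"
    using fin by (intro card_Un_disjoint) auto
  also have "\<dots> = card B + (card A - 1)"
    using a(1) fin by (simp add: card_image inj_on_def)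
  finally show ?thesis
    using card_mono[OF finite_new sub] by simp
qed

end

end

section \<open>A lower bound of Freiman type in terms of generators\<close>

lemma sum_min_mono:
  fixes e f :: nat
  shows "e \<le> f \<Longrightarrow> (\<Sum>i=1..k. min e i) \<le> (\<Sum>i=1..k. min f i)"
  by (intro sum_mono) auto

text \<open>Raising both parameters by one costs \<open>Suc k\<close>, the number of new differences
  guaranteed when one extremal point is not generated.\<close>

lemma sum_min_Suc_Suc:
  fixes e :: nat
  shows "(\<Sum>i=1..Suc k. min (Suc e) i) = Suc k + (\<Sum>i=1..k. min e i)"
proof -
  have "(\<Sum>i=1..Suc k. min (Suc e) i) = (\<Sum>i=0..k. min (Suc e) (Suc i))"
    using sum.shift_bounds_cl_Suc_ivl[of "min (Suc e)" 0 k] by simp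
  also have "\<dots> = (\<Sum>i=0..k. Suc (min e i))" by simp
  also have "\<dots> = Suc k + (\<Sum>i=0..k. min e i)" by (simp add: sum_Suc)
  also have "(\<Sum>i=0..k. min e i) = (\<Sum>i=1..k. min e i)"
    by (simp add: sum.atLeast_Suc_atMost)
  finally show ?thesis .
qed

text \<open>
  A combinatorial form of Freiman's lemma: \<open>card T - 1\<close> plays the role of the dimension plus one,
  and \<open>\<Sum>i=1..k. min e i\<close> equals \<open>e k - e (e - 1) / 2\<close> for \<open>e \<le> k\<close>. Restricting to boundedly many
  parallelogram steps is what makes it meaningful for sets of integers.
\<close>

lemma generating_subset_differences:
  assumes "finite A" "finite B" "card A = k" "card B = k"
  shows "\<exists>T \<subseteq> A \<union> B. A \<union> B \<subseteq> (parallelogram_step ^^ (2 * k)) T \<and>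
           (\<Sum>i=1..k. min (card T - 1) i) \<le> card (differences A B)"
  using assms
proof (induction k arbitrary: A B)
  case 0
  then show ?case by auto
next
  case (Suc k)
  then have ne: "A \<noteq> {}" "B \<noteq> {}" by auto
  define a b where "a = Max A" and "b = Min B"
  interpret extremal_pair A B a b
    by unfold_locales (use Suc.prems ne in \<open>auto simp: a_def b_def\<close>)
  let ?A = "A - {a}" and ?B = "B - {b}"
  let ?F = "\<lambda>k e. \<Sum>i=1..k. min e i :: nat" and ?P = "\<lambda>j. (parallelogram_step ^^ j)"
  have "card ?A = k" "card ?B = k" using Suc.prems a b by auto
  then obtain T where T: "T \<subseteq> ?A \<union> ?B" "?A \<union> ?B \<subseteq> ?P (2 * k) T"
      "?F k (card T - 1) \<le> card (differences ?A ?B)"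
    using Suc.IH[of ?A ?B] fin by auto
  have finT: "finite T" using T(1) fin finite_subset by blast
  let ?n = "card new_differences" and ?X = "?P (2 * k) T"
  have tot: "card (differences A B) \<ge> ?F k (card T - 1) + ?n"
    using card_differences_split T(3) by simp
  \<comment> \<open>Common ending of most cases: \<open>U\<close> extends \<open>T\<close>, reaches
    \<open>a\<close> and \<open>b\<close> within one more step, and the new differences pay for the
    growth of the sum.\<close>
  have fin_step: ?case if "U \<subseteq> A \<union> B" "T \<subseteq> U" "a \<in> ?P (2 * k + 1) U" "b \<in> ?P (2 * k + 1) U"
      "?F (Suc k) (card U - 1) \<le> ?F k (card T - 1) + ?n" for U
  proof -
    have "?A \<union> ?B \<subseteq> ?P (2 * Suc k) U"
      using T(2) parallelogram_steps_mono[OF that(2), of "2 * k"]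
        parallelogram_steps_le[of "2 * k" "2 * Suc k" U] by auto
    moreover have "a \<in> ?P (2 * Suc k) U" "b \<in> ?P (2 * Suc k) U"
      using that parallelogram_steps_le[of "2 * k + 1" "2 * Suc k" U] by auto
    ultimately have "A \<union> B \<subseteq> ?P (2 * Suc k) U" by blast
    then show ?thesis using that(1) le_trans[OF that(5) tot] by blast
  qed
  have TAB: "T \<subseteq> A \<union> B" using T(1) by blast
  have self: "x \<in> ?P j U" if "x \<in> U" for x j U
    using that parallelogram_steps_extensive by blast
  have mono: "?P j T \<subseteq> ?P j (insert x T)" for j x
    by (rule parallelogram_steps_mono) blast
  have F1: "?F (Suc k) (card (insert x T) - 1) \<le> ?F k (card T - 1) + Suc k" for x
  proof -
    have "?F (Suc k) (card (insert x T) - 1) \<le> ?F (Suc k) (Suc (card T - 1))"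
      by (intro sum_min_mono) (auto simp: card_insert_if finT)
    then show ?thesis using sum_min_Suc_Suc[where k = k and e = "card T - 1"] by linarith
  qed
  \<comment> \<open>When \<open>a\<close> is missing, \<open>b\<close> is tested against
    \<open>insert a T\<close>, so that one added generator may serve for both.\<close>
  consider (both) "a \<in> parallelogram_step ?X" "b \<in> parallelogram_step ?X"
    | (max) "a \<in> parallelogram_step ?X" "b \<notin> parallelogram_step ?X"
    | (min) "a \<notin> parallelogram_step ?X" "b \<in> parallelogram_step (?P (2 * k) (insert a T))"
    | (neither) "a \<notin> parallelogram_step ?X" "b \<notin> parallelogram_step (?P (2 * k) (insert a T))"
    by blast
  then show ?case
  proof cases
    case both
    obtain U where U: "U \<subseteq> A \<union> B" "finite U" "card U \<le> ?n + 1" "A \<union> B \<subseteq> ?P (2 * Suc k) U"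
      using generated_by_new Suc.prems by (auto simp: mult_2)
    show ?thesis
    \<comment> \<open>Either the new differences number at least \<open>card T - 1\<close> and pay
      for the added summand while \<open>T\<close> is kept, or the smaller \<open>U\<close> replaces
      \<open>T\<close>. The step count \<open>2 * Suc k\<close> is the one \<open>U\<close>
      needs.\<close>
    proof (cases "card T \<le> card U")
      case True
      then have "?F (Suc k) (card T - 1) \<le> ?F k (card T - 1) + ?n"
        using U(3) by simp
      then show ?thesis using both TAB by (intro fin_step[of T]) auto
    next
      case False
      then have "?F k (card U - 1) \<le> ?F k (card T - 1)" by (intro sum_min_mono) auto
      then have "?F (Suc k) (card U - 1) \<le> ?F k (card T - 1) + ?n"
        using U(3) by (simp add: add_le_mono min.coboundedI1)
      then have "?F (Suc k) (card U - 1) \<le> card (differences A B)" using tot by (rule le_trans)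
      then show ?thesis using U(1,4) by blast
    qed
  next
    case max
    have "Suc k \<le> ?n" using card_new_if_min_not_generated[OF T(2)] max Suc.prems by simp
    then have F: "?F (Suc k) (card (insert b T) - 1) \<le> ?F k (card T - 1) + ?n"
      using F1[of b] by linarith
    have "a \<in> ?P (2 * k + 1) (insert b T)"
      using max(1) mono[of "2 * k + 1" b] by auto
    then show ?thesis using TAB b(1) self F by (intro fin_step[of "insert b T"]) blast+
  next
    case min
    have "Suc k \<le> ?n" using card_new_if_max_not_generated[OF T(2)] min Suc.prems by simp
    then have F: "?F (Suc k) (card (insert a T) - 1) \<le> ?F k (card T - 1) + ?n"
      using F1[of a] by linarith
    have "b \<in> ?P (2 * k + 1) (insert a T)" using min(2) by simp
    then show ?thesis using TAB a(1) self F by (intro fin_step[of "insert a T"]) blast+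
  next
    case neither
    \<comment> \<open>Two added generators raise the sum by at most \<open>Suc k\<close> and
      \<open>k\<close>, matching this count.\<close>
    have "2 * k + 1 \<le> ?n"
      using card_new_if_neither_generated[OF T(2) neither(1) _ mono neither(2)] self Suc.prems by simp
    moreover have "?F (Suc k) (card (insert b (insert a T)) - 1) \<le> ?F (Suc k) (Suc (Suc (card T - 1)))"
      by (intro sum_min_mono) (auto simp: card_insert_if finT)
    moreover have "?F k (Suc (card T - 1)) \<le> k + ?F k (card T - 1)"
    proof -
      have "?F k (Suc (card T - 1)) \<le> (\<Sum>i=1..k. 1 + min (card T - 1) i)" by (intro sum_mono) auto
      then show ?thesis unfolding sum.distrib by simp
    qed
    ultimately have "?F (Suc k) (card (insert b (insert a T)) - 1) \<le> ?F k (card T - 1) + ?n"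
      using sum_min_Suc_Suc[where k = k and e = "Suc (card T - 1)"] by linarith
    then show ?thesis
      using TAB a(1) b(1) self by (intro fin_step[of "insert b (insert a T)"]) blast+
  qed
qed

section \<open>From few differences to few generators\<close>

lemma card_differences_diffset:
  assumes "finite S"
  shows "card (differences S S) \<le> 2 * card (diffset S) + 1"
proof -
  have "differences S S \<subseteq> diffset S \<union> uminus ` diffset S \<union> {0}"
  proof
    fix n assume "n \<in> differences S S"
    then obtain x y where xy: "x \<in> S" "y \<in> S" "n = x - y" unfolding differences_def by blast
    consider "x = y" | "x - y > 0" | "y - x > 0" by linarith
    then show "n \<in> diffset S \<union> uminus ` diffset S \<union> {0}"
    proof cases
      case 3
      then have "y - x \<in> diffset S" using xy unfolding diffset_def by blast
      moreover have "n = - (y - x)" using xy by simp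
      ultimately show ?thesis by blast
    qed (use xy in \<open>auto simp: diffset_def\<close>)
  qed
  then have "card (differences S S) \<le> card (diffset S \<union> uminus ` diffset S \<union> {0})"
    using finite_diffset[OF assms] by (intro card_mono) auto
  also have "\<dots> \<le> card (diffset S) + card (uminus ` diffset S) + card {0::real}"
    by (meson add_le_mono1 card_Un_le le_trans)
  also have "\<dots> \<le> 2 * card (diffset S) + 1"
    using card_image_le[OF finite_diffset[OF assms], of uminus] by simp
  finally show ?thesis .
qed

text \<open>Lowering \<open>e\<close> and \<open>k\<close> together by one changes both sides
  equally; at \<open>k = 0\<close> the left side is at most zero.\<close>

lemma sum_min_ge:
  fixes e :: nat
  shows "real e * real k - real e * (real e - 1) / 2 \<le> real (\<Sum>i=1..k. min e i)"
proof (induction k arbitrary: e)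
  case 0
  then show ?case by (cases e) auto
next
  case (Suc k)
  show ?case
  proof (cases e)
    case (Suc f)
    then show ?thesis
      using Suc.IH[of f] unfolding Suc sum_min_Suc_Suc by (simp add: field_simps)
  qed simp
qed

text \<open>The factor \<open>4/9\<close> comes from \<open>2c \<le> 4c\<^sup>2/9 + 9/4\<close>, which is nearly tight at the critical value \<open>c\<^sup>2 = 5\<close>.\<close>

lemma dimension_inequality:
  fixes c e k :: real
  assumes "c\<^sup>2 < e" "e \<ge> 5" "k \<ge> e\<^sup>2"
  shows "2 * (c * k + 1) + 1 \<le> e * k - e * (e - 1) / 2"
proof -
  have "(2 * c / 3 - 3 / 2)\<^sup>2 \<ge> 0" by simp
  then have "e - 2 * c \<ge> 5 / 9 * e - 9 / 4"
    using assms(1) by (simp add: power2_eq_square algebra_simps)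
  then have "(e - 2 * c) * k \<ge> (5 / 9 * e - 9 / 4) * e\<^sup>2"
    using assms by (intro mult_mono) auto
  moreover have "(5 / 9 * e - 9 / 4) * e\<^sup>2 \<ge> e * (e - 1) / 2 + 3"
  proof -
    \<comment> \<open>The shift makes all coefficients of the cubic positive; the constant term is
      only \<open>7/36\<close>.\<close>
    define u where "u = e - 5"
    have "u \<ge> 0" using assms u_def by simp
    have "(5 / 9 * e - 9 / 4) * e\<^sup>2 - (e * (e - 1) / 2 + 3)
        = 5 / 9 * u^3 + (25 / 3 - 11 / 4) * u\<^sup>2 + (125 / 3 - 27) * u + (625 / 9 - 225 / 4 - 13)"
      unfolding u_def by (simp add: power2_eq_square power3_eq_cube field_simps)
    also have "\<dots> \<ge> 0" using \<open>u \<ge> 0\<close> by (intro add_nonneg_nonneg mult_nonneg_nonneg) auto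
    finally show ?thesis by simp
  qed
  ultimately have "(e - 2 * c) * k \<ge> e * (e - 1) / 2 + 3" by linarith
  moreover have "(e - 2 * c) * k = e * k - 2 * (c * k)" by (simp add: algebra_simps)
  ultimately show ?thesis by simp
qed

text \<open>With \<open>e = nat \<lfloor>c\<^sup>2\<rfloor> + 1\<close>, more than \<open>e\<close>
  generators would force \<open>e k - e (e - 1) / 2\<close> signed differences, but there are fewer
  than \<open>2 (c k + 1) + 1\<close>.\<close>

lemma few_differences_generated:
  fixes c :: real and k :: nat
  assumes c: "c \<ge> 2" and k: "real k > (c\<^sup>2 + 1)\<^sup>2"
    and S: "card S = k" "real (card (diffset S)) < c * real k + 1"
  shows "\<exists>T \<subseteq> S. T \<noteq> {} \<and> card T \<le> nat \<lfloor>c\<^sup>2\<rfloor> + 1 \<and> S \<subseteq> (parallelogram_step ^^ (2 * k)) T"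
proof -
  have "k > 0" using k by (metis gr0I not_square_less_zero of_nat_0 power2_eq_square)
  then have finS: "finite S" "S \<noteq> {}" using S(1) card_gt_0_iff[of S] by simp_all
  obtain T where T: "T \<subseteq> S" "S \<subseteq> (parallelogram_step ^^ (2 * k)) T"
      "(\<Sum>i=1..k. min (card T - 1) i) \<le> card (differences S S)"
    using generating_subset_differences[of S S k] finS S by auto
  \<comment> \<open>The least integer above \<open>c\<^sup>2\<close>; it is at most
    \<open>c\<^sup>2 + 1\<close>, so \<open>e\<^sup>2 < k\<close>.\<close>
  define e where "e = nat \<lfloor>c\<^sup>2\<rfloor> + 1"
  have c4: "c\<^sup>2 \<ge> 4" using power_mono[OF c, of 2] by simp
  have "card T \<le> e"
  proof (rule ccontr)
    assume "\<not> card T \<le> e"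
    then have "(\<Sum>i=1..k. min e i) \<le> (\<Sum>i=1..k. min (card T - 1) i)"
      by (intro sum_min_mono) auto
    then have "real (\<Sum>i=1..k. min e i) \<le> real (2 * card (diffset S) + 1)"
      using T(3) card_differences_diffset[OF finS(1)] by (intro of_nat_mono) linarith
    then have "real e * real k - real e * (real e - 1) / 2 < 2 * (c * real k + 1) + 1"
      using sum_min_ge[of e k] S(2) by simp
    moreover have re: "real e = of_int \<lfloor>c\<^sup>2\<rfloor> + 1" unfolding e_def using c4 by simp
    have e5: "real e \<ge> 5" unfolding re using c4 le_floor_iff[of 4 "c\<^sup>2"] by simp
    have "real e \<le> c\<^sup>2 + 1" unfolding re by simp
    then have "(real e)\<^sup>2 \<le> (c\<^sup>2 + 1)\<^sup>2" by (intro power_mono) auto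
    then have "2 * (c * real k + 1) + 1 \<le> real e * real k - real e * (real e - 1) / 2"
      using k e5 re by (intro dimension_inequality) linarith+
    ultimately show False by simp
  qed
  moreover have "T \<noteq> {}" using T(2) finS parallelogram_steps_empty by auto
  ultimately show ?thesis using T unfolding e_def by blast
qed

text \<open>Each set is determined by a list of length \<open>r\<close> enumerating \<open>T\<close>
  and a subset of the at most \<open>r ^ (3 ^ j)\<close> points generated from it.\<close>

lemma card_generated_sets:
  fixes V :: "real set" and r :: nat
  assumes V: "finite V"
    and F: "\<And>S. S \<in> F \<Longrightarrow> \<exists>T \<subseteq> V. T \<noteq> {} \<and> card T \<le> r \<and> S \<subseteq> (parallelogram_step ^^ j) T"
  shows "card F \<le> card V ^ r * 2 ^ (r ^ (3 ^ j))"
proof -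
  let ?L = "{xs. set xs \<subseteq> V \<and> length xs = r}" and ?W = "\<lambda>xs. Pow ((parallelogram_step ^^ j) (set xs))"
  have finL: "finite ?L" using V by (rule finite_lists_length_eq)
  have "F \<subseteq> (\<Union>xs\<in>?L. ?W xs)"
  proof
    fix S assume "S \<in> F"
    then obtain T where T: "T \<subseteq> V" "T \<noteq> {}" "card T \<le> r" "S \<subseteq> (parallelogram_step ^^ j) T"
      using F by blast
    then have "finite T" using V finite_subset by blast
    then obtain ys where "set ys = T" "distinct ys" using finite_distinct_list by blast
    then have ys: "set ys = T" "length ys = card T" using distinct_card by force+
    \<comment> \<open>Repeating \<open>t\<close> pads every enumeration to length exactly
      \<open>r\<close>; here \<open>T \<noteq> {}\<close> enters.\<close>
    obtain t where "t \<in> T" using T(2) by blast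
    then have "set (ys @ replicate (r - card T) t) = T" using ys by auto
    moreover have "length (ys @ replicate (r - card T) t) = r" using ys T(3) by simp
    ultimately show "S \<in> (\<Union>xs\<in>?L. ?W xs)"
      using T by (intro UN_I[of "ys @ replicate (r - card T) t"]) simp_all
  qed
  moreover have "finite (\<Union>xs\<in>?L. ?W xs)"
    using finL by (intro finite_UN_I) (simp_all add: card_parallelogram_steps)
  ultimately have "card F \<le> card (\<Union>xs\<in>?L. ?W xs)" by (intro card_mono)
  also have "\<dots> \<le> (\<Sum>xs\<in>?L. card (?W xs))" using finL by (rule card_UN_le)
  also have "\<dots> \<le> (\<Sum>xs\<in>?L. 2 ^ (r ^ (3 ^ j)))"
  proof (rule sum_mono)
    fix xs assume xs: "xs \<in> ?L"
    have "card ((parallelogram_step ^^ j) (set xs)) \<le> card (set xs) ^ (3 ^ j)"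
      using card_parallelogram_steps by blast
    also have "\<dots> \<le> r ^ (3 ^ j)"
      using xs card_length[of xs] by (intro power_mono) auto
    finally show "card (?W xs) \<le> 2 ^ (r ^ (3 ^ j))"
      by (simp add: card_Pow card_parallelogram_steps)
  qed
  also have "\<dots> = card V ^ r * 2 ^ (r ^ (3 ^ j))"
    using V by (simp add: card_lists_length_eq)
  finally show ?thesis .
qed

section \<open>The deletion argument\<close>

text \<open>Division-free form of: a fixed \<open>k\<close>-set lies in a random
  \<open>m\<close>-subset with probability at most \<open>(m / N) ^ k\<close>. Each step uses
  \<open>(m - k) / (N - k) \<le> m / N\<close>.\<close>

lemma binomial_ratio:
  fixes N m k :: nat
  assumes "k \<le> m" "m \<le> N"
  shows "((N - k) choose (m - k)) * N ^ k \<le> (N choose m) * m ^ k"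
  using assms
proof (induction k)
  case (Suc k)
  let ?B = "(N - k) choose (m - k)" and ?C = "(N - Suc k) choose (m - Suc k)"
  have "Suc (N - Suc k) = N - k" "Suc (m - Suc k) = m - k" using Suc.prems by auto
  then have absorb: "(N - k) * ?C = ?B * (m - k)"
    using Suc_times_binomial_eq[of "N - Suc k" "m - Suc k"] by simp
  have "(m - k) * N \<le> m * (N - k)"
    using Suc.prems by (simp add: diff_mult_distrib diff_mult_distrib2 mult.commute diff_le_mono2)
  then have "((m - k) * N) * (?B * N ^ k) \<le> (m * (N - k)) * ((N choose m) * m ^ k)"
    using Suc by (intro mult_le_mono[OF _ Suc.IH]) simp_all
  moreover have "((m - k) * N) * (?B * N ^ k) = (N - k) * (?C * N ^ Suc k)"
  proof -
    have "((m - k) * N) * (?B * N ^ k) = (?B * (m - k)) * N ^ Suc k" by simp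
    then show ?thesis unfolding absorb[symmetric] by (simp add: mult.assoc)
  qed
  moreover have "(m * (N - k)) * ((N choose m) * m ^ k) = (N - k) * ((N choose m) * m ^ Suc k)" by simp
  ultimately have "(N - k) * (?C * N ^ Suc k) \<le> (N - k) * ((N choose m) * m ^ Suc k)" by linarith
  then show ?case using Suc.prems by simp
qed simp

lemma card_supersets:
  assumes "finite V" "S \<subseteq> V" "card S \<le> m"
  shows "card {M. M \<subseteq> V \<and> card M = m \<and> S \<subseteq> M} = (card V - card S) choose (m - card S)"
proof -
  have finS: "finite S" using assms finite_subset by blast
  have fin: "finite M" if "M \<subseteq> V" for M using that assms(1) finite_subset by blast
  have "bij_betw (\<lambda>M. M - S) {M. M \<subseteq> V \<and> card M = m \<and> S \<subseteq> M}
          {R. R \<subseteq> V - S \<and> card R = m - card S}"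
  proof (rule bij_betwI[where g = "\<lambda>R. R \<union> S"])
    show "(\<lambda>R. R \<union> S) \<in> {R. R \<subseteq> V - S \<and> card R = m - card S} \<rightarrow>
            {M. M \<subseteq> V \<and> card M = m \<and> S \<subseteq> M}"
    proof
      fix R assume R: "R \<in> {R. R \<subseteq> V - S \<and> card R = m - card S}"
      then have "card (R \<union> S) = card R + card S"
        using finS fin[of R] by (intro card_Un_disjoint) auto
      then show "R \<union> S \<in> {M. M \<subseteq> V \<and> card M = m \<and> S \<subseteq> M}" using R assms by auto
    qed
  qed (use finS in \<open>auto simp: card_Diff_subset\<close>)
  then have "card {M. M \<subseteq> V \<and> card M = m \<and> S \<subseteq> M} = card {R. R \<subseteq> V - S \<and> card R = m - card S}"
    by (rule bij_betw_same_card)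
  also have "\<dots> = card (V - S) choose (m - card S)"
    using assms(1) by (intro n_subsets) simp
  finally show ?thesis using assms finS by (simp add: card_Diff_subset)
qed

text \<open>Pairs \<open>S \<subseteq> M\<close> are counted in two ways: some \<open>M\<close> does
  no worse than the average, which \<open>binomial_ratio\<close> bounds.\<close>

lemma exists_subset_few_edges:
  fixes F :: "'a set set"
  assumes V: "finite V" "m \<le> card V" and k: "k \<le> m"
    and F: "\<And>S. S \<in> F \<Longrightarrow> S \<subseteq> V \<and> card S = k"
  shows "\<exists>M \<subseteq> V. card M = m \<and> card {S \<in> F. S \<subseteq> M} * card V ^ k \<le> card F * m ^ k"
proof (rule ccontr)
  assume neg: "\<not> ?thesis"
  let ?\<M> = "{M. M \<subseteq> V \<and> card M = m}" and ?N = "card V"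
  have finF: "finite F" using F V(1) by (intro finite_subset[of F "Pow V"]) auto
  have finM: "finite ?\<M>" using V by simp
  have cardM: "card ?\<M> = ?N choose m" using V(1) by (rule n_subsets)
  have pos: "?N choose m > 0" using V(2) by simp
  then have ne: "?\<M> \<noteq> {}" using cardM by force
  have "(?N choose m) * (card F * m ^ k) = (\<Sum>M\<in>?\<M>. card F * m ^ k)" using cardM by simp
  also have "\<dots> < (\<Sum>M\<in>?\<M>. card {S \<in> F. S \<subseteq> M} * ?N ^ k)"
    using neg finM ne by (intro sum_strict_mono) (auto simp: not_le)
  also have "\<dots> = (\<Sum>M\<in>?\<M>. card {S \<in> F. S \<subseteq> M}) * ?N ^ k" by (simp add: sum_distrib_right)
  also have "(\<Sum>M\<in>?\<M>. card {S \<in> F. S \<subseteq> M}) = (\<Sum>S\<in>F. card {M \<in> ?\<M>. S \<subseteq> M})"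
    using sum_multicount_gen[OF finM finF, of "\<lambda>M S. S \<subseteq> M" "\<lambda>S. card {M \<in> ?\<M>. S \<subseteq> M}"] by simp
  also have "\<dots> = (\<Sum>S\<in>F. (?N - k) choose (m - k))"
  proof (rule sum.cong)
    fix S assume "S \<in> F"
    then show "card {M \<in> ?\<M>. S \<subseteq> M} = (?N - k) choose (m - k)"
      using card_supersets[OF V(1), of S m] F k by (simp add: conj_assoc)
  qed simp
  also have "\<dots> * ?N ^ k = card F * (((?N - k) choose (m - k)) * ?N ^ k)" by simp
  also have "\<dots> \<le> card F * ((?N choose m) * m ^ k)"
    using binomial_ratio[OF k V(2)] by (rule mult_le_mono2)
  finally show False by (simp add: mult_ac)
qed

text \<open>The hypothesis \<open>count\<close> says that the bound on the average number of bad
  sets in a \<open>2 * n\<close>-subset is at most \<open>n\<close>, so deletion leaves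
  \<open>n\<close> points.\<close>

lemma g_le:
  assumes c: "c \<ge> 2" and k: "real k > (c\<^sup>2 + 1)\<^sup>2" and r: "r = nat \<lfloor>c\<^sup>2\<rfloor> + 1"
    and n: "n \<ge> k" and N: "2 * n \<le> N"
    and count: "N ^ r * 2 ^ (r ^ (3 ^ (2 * k))) * (2 * n) ^ k \<le> n * N ^ k"
  shows "g n k (c * real k + 1) \<le> N"
proof -
  let ?l = "c * real k + 1"
  define V where "V = real ` {1..N}"
  have V: "finite V" "card V = N" unfolding V_def by (auto simp: card_image inj_on_def)
  define F where "F = {S. S \<subseteq> V \<and> card S = k \<and> real (card (diffset S)) < ?l}"
  have "k > 0" using k by (metis gr0I not_square_less_zero of_nat_0 power2_eq_square)
  then have "N > 0" using n N by simp
  have "card F \<le> card V ^ r * 2 ^ (r ^ (3 ^ (2 * k)))"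
  proof (rule card_generated_sets[OF V(1)])
    fix S assume "S \<in> F"
    then have "S \<subseteq> V" "card S = k" "real (card (diffset S)) < ?l" by (auto simp: F_def)
    then show "\<exists>T \<subseteq> V. T \<noteq> {} \<and> card T \<le> r \<and> S \<subseteq> (parallelogram_step ^^ (2 * k)) T"
      using few_differences_generated[OF c k, of S] unfolding r by blast
  qed
  then have "card F * (2 * n) ^ k \<le> n * N ^ k"
    using count V mult_le_mono1 le_trans by metis
  moreover obtain M where M: "M \<subseteq> V" "card M = 2 * n"
      "card {S \<in> F. S \<subseteq> M} * card V ^ k \<le> card F * (2 * n) ^ k"
    using exists_subset_few_edges[of V "2 * n" k F] V N n by (auto simp: F_def)
  ultimately have "card {S \<in> F. S \<subseteq> M} * N ^ k \<le> n * N ^ k"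
    unfolding V(2) by linarith
  then have few: "card {S \<in> F. S \<subseteq> M} \<le> n" using \<open>N > 0\<close> by simp
  have ne: "S \<noteq> {}" if "S \<in> F" for S using that \<open>k > 0\<close> by (auto simp: F_def)
  define R where "R = (\<lambda>S. SOME x. x \<in> S) ` {S \<in> F. S \<subseteq> M}"
  have finF: "finite F" unfolding F_def using V(1) by simp
  have finM: "finite M" using M(1) V(1) finite_subset by blast
  have "card R \<le> card {S \<in> F. S \<subseteq> M}" unfolding R_def using finF by (intro card_image_le) simp
  then have "card R \<le> n" using few by simp
  moreover have "finite R" unfolding R_def using finF by simp
  ultimately have "card (M - R) \<ge> n" using diff_card_le_card_Diff[of R M] M(2) by simp
  then obtain A where A: "A \<subseteq> M - R" "card A = n" "finite A"
    using obtain_subset_with_card_n by metis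
  have "locally_diverse n k ?l A"
    unfolding locally_diverse_def
  proof (intro conjI allI impI)
    fix A' assume A': "A' \<subseteq> A \<and> card A' = k"
    show "?l \<le> real (card (diffset A'))"
    proof (rule ccontr)
      assume "\<not> ?thesis"
      then have in_F: "A' \<in> F" "A' \<subseteq> M" using A' A(1) M(1) by (auto simp: F_def)
      then have "(SOME x. x \<in> A') \<in> R" unfolding R_def by blast
      moreover have "(SOME x. x \<in> A') \<in> A'" using ne[OF in_F(1)] by (simp add: some_in_eq)
      ultimately show False using A' A(1) by blast
    qed
  qed (use A in auto)
  then have "g n k ?l \<le> card (diffset A)"
    unfolding g_def by (intro cInf_lower) auto
  \<comment> \<open>\<open>V\<close> consists of the integers from \<open>1\<close> to
    \<open>N\<close>, so it contains its own positive differences.\<close>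
  also have "\<dots> \<le> card V"
  proof (intro card_mono V(1) subsetI)
    fix x assume "x \<in> diffset A"
    then obtain y z where yz: "y \<in> V" "z \<in> V" "x = y - z" "x > 0"
      using A(1) M(1) unfolding diffset_def by auto
    then obtain i j where ij: "i \<in> {1..N}" "j \<in> {1..N}" "y = real i" "z = real j"
      unfolding V_def by blast
    then have "x = real (i - j)" "i - j \<in> {1..N}" using yz by auto
    then show "x \<in> V" unfolding V_def by blast
  qed
  finally show ?thesis using V by simp
qed

section \<open>Choice of the interval length\<close>

theorem theorem1p4:
  fixes c :: real and k :: nat
  assumes "c \<ge> 2" and "real k > (c\<^sup>2 + 1)\<^sup>2"
  shows "(\<lambda>n::nat. real (g n k (c * real k + 1)))
           \<in> O(\<lambda>n. real n powr (1 + (c\<^sup>2 + 1) / real k))"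
proof -
  define r where "r = nat \<lfloor>c\<^sup>2\<rfloor> + 1"
  define t where "t = c\<^sup>2 + 1"
  define p where "p = 1 + t / real k"
  define Q :: nat where "Q = 2 ^ (r ^ (3 ^ (2 * k)))"
  \<comment> \<open>\<open>K\<close> absorbs the \<open>2 ^ k\<close> of \<open>(2 * n) ^ k\<close>
    and the number \<open>Q\<close> of subsets per generating list.\<close>
  define K :: nat where "K = 2 ^ k * Q"
  have t1: "t \<ge> 1" unfolding t_def by simp
  have rt: "real r \<le> t" unfolding r_def t_def by simp
  have kt: "real k > t\<^sup>2" using assms(2) t_def by simp
  moreover have "t\<^sup>2 \<ge> t" using t1 by (simp add: power2_eq_square)
  ultimately have "r < k" "k > 0" using rt t1 by linarith+
  have p1: "p \<ge> 1" unfolding p_def using t1 by simp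
  have Q1: "Q \<ge> 1" unfolding Q_def by simp
  have "2 ^ 1 \<le> (2::nat) ^ k" using \<open>k > 0\<close> by (intro power_increasing) auto
  then have K2: "K \<ge> 2" unfolding K_def using Q1 mult_le_mono[of 2 "2 ^ k" 1 Q] by simp
  \<comment> \<open>Since \<open>k > t\<^sup>2\<close>, this is at least \<open>k - 1\<close>, the
    power of \<open>n\<close> left after one factor \<open>n\<close> is cancelled.\<close>
  have "(1 + t / k) * (real k - t) = k - t\<^sup>2 / k"
    using \<open>k > 0\<close> by (simp add: field_simps power2_eq_square)
  moreover have "t\<^sup>2 / k \<le> 1" using kt \<open>k > 0\<close> by simp
  moreover have "p * real (k - r) \<ge> p * (real k - t)"
    using rt p1 \<open>r < k\<close> by (intro mult_left_mono) (auto simp: of_nat_diff)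
  moreover have "real (k - 1) = real k - 1" using \<open>k > 0\<close> by (simp add: of_nat_diff)
  ultimately have pk: "p * real (k - r) \<ge> real (k - 1)"
    unfolding p_def by linarith
  have "norm (real (g n k (c * real k + 1))) \<le> real (K + 1) * norm (real n powr p)" if "n \<ge> k" for n
  proof -
    have n: "n \<ge> 1" using that \<open>k > 0\<close> by simp
    define N where "N = nat \<lceil>real K * real n powr p\<rceil>"
    have N_ge: "real N \<ge> real K * real n powr p" unfolding N_def by linarith
    have np: "real n powr p \<ge> real n" using n p1 powr_mono[of 1 p "real n"] by simp
    have "real K * real n powr p \<ge> 0" by simp
    \<comment> \<open>Rounding up costs at most one, absorbed since \<open>n powr p \<ge> 1\<close>;
      hence the constant \<open>K + 1\<close>.\<close>
    then have "real N \<le> real K * real n powr p + 1" unfolding N_def by linarith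
    then have N_le: "real N \<le> real (K + 1) * real n powr p"
      using np n by (simp add: algebra_simps)
    have "2 * real n \<le> real K * real n powr p" using K2 np by (intro mult_mono) auto
    then have N2: "2 * n \<le> N" using N_ge by linarith
    \<comment> \<open>The goal is \<open>count\<close> of \<open>g_le\<close> with
      \<open>n * N ^ r\<close> cancelled: \<open>K * n ^ (k - 1) \<le> N ^ (k - r)\<close>.\<close>
    have "real K * real n ^ (k - 1) \<le> real K ^ (k - r) * (real n powr p) ^ (k - r)"
    proof (intro mult_mono)
      show "real K \<le> real K ^ (k - r)"
        using K2 \<open>r < k\<close> power_increasing[of 1 "k - r" "real K"] by simp
      have "real n ^ (k - 1) = real n powr real (k - 1)" using n by (simp add: powr_realpow)
      also have "\<dots> \<le> real n powr (p * real (k - r))" using pk n by (intro powr_mono) auto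
      also have "\<dots> = (real n powr p) ^ (k - r)"
        using n by (simp add: powr_powr[symmetric] powr_realpow)
      finally show "real n ^ (k - 1) \<le> (real n powr p) ^ (k - r)" .
    qed auto
    also have "\<dots> = (real K * real n powr p) ^ (k - r)" by (simp add: power_mult_distrib)
    also have "\<dots> \<le> real N ^ (k - r)" using N_ge by (intro power_mono) auto
    finally have "real (K * n ^ (k - 1)) \<le> real (N ^ (k - r))" by simp
    then have main: "K * n ^ (k - 1) \<le> N ^ (k - r)" by (simp only: of_nat_le_iff)
    have "N ^ r * Q * (2 * n) ^ k = n * (N ^ r * (K * n ^ (k - 1)))"
      using \<open>k > 0\<close> unfolding K_def by (cases k) (simp_all add: power_mult_distrib mult_ac)
    also have "\<dots> \<le> n * (N ^ r * N ^ (k - r))" using main by (intro mult_le_mono) auto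
    also have "\<dots> = n * N ^ k" using \<open>r < k\<close> by (simp add: power_add[symmetric])
    finally have "g n k (c * real k + 1) \<le> N"
      using g_le[OF assms r_def that N2] unfolding Q_def by simp
    then show ?thesis using N_le by simp
  qed
  then have "eventually (\<lambda>n. norm (real (g n k (c * real k + 1))) \<le> real (K + 1) * norm (real n powr p)) at_top"
    unfolding eventually_at_top_linorder by blast
  then have "(\<lambda>n::nat. real (g n k (c * real k + 1))) \<in> O(\<lambda>n. real n powr p)"
    by (rule bigoI)
  then show ?thesis unfolding p_def t_def .
qed

end
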